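(* Let $G$ be a finite simple graph with no isolated vertices. Then $\check s(G)=|V(G)|$ if and only if $G$ is isomorphic to one of: $K_3$; $K_{1,j}$ with $j\geq 2$; $\hat K^{j}_3$ with $j\geq 1$; $\hat K^{j+}_3$ with $j\geq 3$; or the disjoint union $K_3\cup K_{1,j}$ with $j\geq 3$.
   Context: For a proper edge coloring $\varphi$ of a graph $G$, the palette of a vertex $v$ is the set of colors on edges incident with $v$. The palette index $\check s(G)$ is the minimum number of distinct palettes over all proper edge colorings of $G$. $\hat K^{j}_3$ denotes the graph obtained from $K_3$ and the star $K_{1,j}$ by identifying the central vertex of $K_{1,j}$ with a vertex of $K_3$. $\hat K^{j+}_3$ denotes the graph obtained from disjoint copies of $K_3$ and $K_{1,j}$ by adding an edge between the central vertex of $K_{1,j}$ and some vertex of $K_3$. *)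

theory Defs
  imports Main
begin

type_synonym 'a ugraph = "'a set \<times> 'a set set"

abbreviation verts :: "'a ugraph \<Rightarrow> 'a set" where
  "verts G \<equiv> fst G"

abbreviation edges :: "'a ugraph \<Rightarrow> 'a set set" where
  "edges G \<equiv> snd G"

definition finite_simple_graph :: "'a ugraph \<Rightarrow> bool" where
  "finite_simple_graph G \<longleftrightarrow>
     finite (verts G) \<and> (\<forall>e\<in>edges G. e \<subseteq> verts G \<and> card e = 2)"

definition isolated_vertex :: "'a ugraph \<Rightarrow> 'a \<Rightarrow> bool" where
  "isolated_vertex G v \<longleftrightarrow> v \<in> verts G \<and> (\<forall>e\<in>edges G. v \<notin> e)"

definition graph_iso :: "'a ugraph \<Rightarrow> 'b ugraph \<Rightarrow> bool" where
  "graph_iso G H \<longleftrightarrow>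
     (\<exists>f. bij_betw f (verts G) (verts H) \<and>
          (\<forall>u\<in>verts G. \<forall>v\<in>verts G. {u, v} \<in> edges G \<longleftrightarrow> {f u, f v} \<in> edges H))"

(* Colors are natural numbers, an unlimited supply; only the values on edges matter. *)
definition proper_edge_coloring :: "'a ugraph \<Rightarrow> ('a set \<Rightarrow> nat) \<Rightarrow> bool" where
  "proper_edge_coloring G \<phi> \<longleftrightarrow>
     (\<forall>e\<in>edges G. \<forall>f\<in>edges G. e \<noteq> f \<and> e \<inter> f \<noteq> {} \<longrightarrow> \<phi> e \<noteq> \<phi> f)"

definition palette :: "'a ugraph \<Rightarrow> ('a set \<Rightarrow> nat) \<Rightarrow> 'a \<Rightarrow> nat set" where
  "palette G \<phi> v = \<phi> ` {e \<in> edges G. v \<in> e}"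

definition palette_index :: "'a ugraph \<Rightarrow> nat" where
  "palette_index G =
     (LEAST n. \<exists>\<phi>. proper_edge_coloring G \<phi> \<and> n = card (palette G \<phi> ` verts G))"

definition complete_graph :: "nat \<Rightarrow> nat ugraph" where
  "complete_graph n = ({..<n}, {e. e \<subseteq> {..<n} \<and> card e = 2})"

(* The star K_{1,j}, with central vertex 0 and leaves 1, ..., j. *)
definition star_graph :: "nat \<Rightarrow> nat ugraph" where
  "star_graph j = ({0..j}, {{0, i} | i. i \<in> {1..j}})"

definition disjoint_union :: "'a ugraph \<Rightarrow> 'b ugraph \<Rightarrow> ('a + 'b) ugraph" where
  "disjoint_union G H =
     (Inl ` verts G \<union> Inr ` verts H, (`) Inl ` edges G \<union> (`) Inr ` edges H)"

definition identify_vertices :: "'a \<Rightarrow> 'a \<Rightarrow> 'a ugraph \<Rightarrow> 'a ugraph" where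
  "identify_vertices x y G =
     (let q = (\<lambda>v. if v = y then x else v) in (q ` verts G, (`) q ` edges G))"

definition add_edge :: "'a \<Rightarrow> 'a \<Rightarrow> 'a ugraph \<Rightarrow> 'a ugraph" where
  "add_edge x y G = (verts G, insert {x, y} (edges G))"

(* In the next two definitions the vertex 0 of K_3 is used; by symmetry of K_3 the
   choice is immaterial up to isomorphism. *)
definition K3_hat :: "nat \<Rightarrow> (nat + nat) ugraph" where
  "K3_hat j =
     identify_vertices (Inl 0) (Inr 0) (disjoint_union (complete_graph 3) (star_graph j))"

definition K3_hat_plus :: "nat \<Rightarrow> (nat + nat) ugraph" where
  "K3_hat_plus j =
     add_edge (Inl 0) (Inr 0) (disjoint_union (complete_graph 3) (star_graph j))"

end

theory Submission
  imports Defs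
begin

text \<open>
  Two vertices \<open>u \<noteq> v\<close> of equal degree can be given the same palette: colour the edges at \<open>u\<close>
  injectively, copy these colours to the edges at \<open>v\<close> along a bijection from
  \<open>N(v) - {u}\<close> to \<open>N(u) - {v}\<close> without fixed points, and give all other edges new colours. Such a
  bijection is missing only if both sets equal the same singleton \<open>{w}\<close>, and in that case the
  palettes differ in every proper colouring. Hence the palette index is \<open>|V|\<close> iff every two vertices
  of equal degree are leaves with a common neighbour or degree-2 vertices of a common triangle.

  In such a graph all leaves hang on one vertex \<open>x\<close>, there are at most three vertices of degree 2, and
  the vertices of degree at least 3 have distinct degrees. High-degree vertices other than \<open>x\<close> and
  the apex of a triangle on two degree-2 vertices are adjacent almost only to each other; being
  distinct and at least 3, their degrees would then be too large for their number, so there are none.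
\<close>

section \<open>Neighbourhoods, degrees and the rigidity condition\<close>

definition nbhd :: "'a ugraph \<Rightarrow> 'a \<Rightarrow> 'a set" where
  "nbhd G v = {u. {v, u} \<in> edges G}"

definition deg :: "'a ugraph \<Rightarrow> 'a \<Rightarrow> nat" where
  "deg G v = card (nbhd G v)"

text \<open>One formula covers both exceptional pairs: nonadjacent \<open>u\<close>,
  \<open>v\<close> are leaves at \<open>w\<close>, and adjacent ones have degree 2 and form a
  triangle with \<open>w\<close>. The ends of an isolated edge fail it, since both differences are
  empty.\<close>

definition rigid :: "'a ugraph \<Rightarrow> bool" where
  "rigid G \<longleftrightarrow> (\<forall>u\<in>verts G. \<forall>v\<in>verts G. u \<noteq> v \<and> deg G u = deg G v \<longrightarrow>
     (\<exists>w. nbhd G u - {v} = {w} \<and> nbhd G v - {u} = {w}))"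

lemma nbhd_sym: "u \<in> nbhd G v \<longleftrightarrow> v \<in> nbhd G u"
  by (simp add: nbhd_def insert_commute)

lemma nbhd_subset:
  assumes "finite_simple_graph G"
  shows "nbhd G v \<subseteq> verts G"
  using assms by (auto simp: nbhd_def finite_simple_graph_def)

lemma finite_nbhd:
  assumes "finite_simple_graph G"
  shows "finite (nbhd G v)"
  using assms finite_subset[OF nbhd_subset[OF assms]] by (simp add: finite_simple_graph_def)

lemma not_in_nbhd_self:
  assumes "finite_simple_graph G"
  shows "v \<notin> nbhd G v"
  using assms by (force simp: nbhd_def finite_simple_graph_def)

lemma incident_edges_eq_image:
  assumes "finite_simple_graph G"
  shows "{e \<in> edges G. v \<in> e} = (\<lambda>z. {v, z}) ` nbhd G v"
proof (intro equalityI subsetI)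
  fix e assume e: "e \<in> {e \<in> edges G. v \<in> e}"
  then have "card e = 2" using assms by (auto simp: finite_simple_graph_def)
  then obtain a b where "e = {a, b}" by (auto simp: card_2_iff)
  then show "e \<in> (\<lambda>z. {v, z}) ` nbhd G v"
    using e by (auto simp: nbhd_def insert_commute)
qed (auto simp: nbhd_def)

lemma palette_eq_image:
  assumes "finite_simple_graph G"
  shows "palette G \<phi> v = (\<lambda>z. \<phi> {v, z}) ` nbhd G v"
  unfolding palette_def incident_edges_eq_image[OF assms] by (simp add: image_image)

lemma finite_edges:
  assumes "finite_simple_graph G"
  shows "finite (edges G)"
proof (rule finite_subset)
  show "edges G \<subseteq> Pow (verts G)" using assms by (auto simp: finite_simple_graph_def)
  show "finite (Pow (verts G))" using assms by (simp add: finite_simple_graph_def)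
qed

subsection \<open>Palettes and degrees\<close>

text \<open>A bijection with the fewest fixed points has none: otherwise swap the values at a fixed
  point and at any other point.\<close>

lemma ex_bij_betw_no_fixpoint:
  assumes "finite S" "finite T" "card S = card T" and not_same: "\<And>w. \<not> (S = {w} \<and> T = {w})"
  shows "\<exists>f. bij_betw f S T \<and> (\<forall>x\<in>S. f x \<noteq> x)"
proof -
  define m where "m f = card {x \<in> S. f x = x}" for f :: "'a \<Rightarrow> 'a"
  obtain f where f: "bij_betw f S T" and minim: "\<And>g. bij_betw g S T \<Longrightarrow> m f \<le> m g"
    using ex_has_least_nat[of "\<lambda>f. bij_betw f S T" _ m]
      finite_same_card_bij[OF assms(1-3)] by blast
  have False if x: "x \<in> S" "f x = x" for x
  proof -
    have "S \<noteq> {x}" using not_same[of x] f x by (auto simp: bij_betw_def)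
    then obtain y where y: "y \<in> S" "y \<noteq> x" using x by blast
    define g where "g = f(x := f y, y := x)"
    have "f y \<noteq> x" using f x y by (metis bij_betw_imp_inj_on inj_onD)
    have inj: "inj_on f S" and im: "f ` S = T" using f by (auto simp: bij_betw_def)
    have "inj_on g S"
      using inj x y unfolding g_def inj_on_def by (auto; metis)
    moreover have "g ` S \<subseteq> T" using im x y unfolding g_def by (auto intro: rev_image_eqI)
    ultimately have "bij_betw g S T"
      using assms(1-3) by (metis bij_betw_def card_image card_subset_eq)
    then have "m f \<le> m g" by (rule minim)
    \<comment> \<open>The swap destroys the fixed point \<open>x\<close>, as
      \<open>g x = f y \<noteq> x\<close>, and creates none, as
      \<open>g y = x \<noteq> y\<close>.\<close>
    moreover have "{z \<in> S. g z = z} \<subset> {z \<in> S. f z = z}"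
      using x y \<open>f y \<noteq> x\<close> unfolding g_def by (auto split: if_splits)
    then have "m g < m f" unfolding m_def using assms(1) by (simp add: psubset_card_mono)
    ultimately show False by simp
  qed
  then show ?thesis using f by blast
qed

lemma ex_injective_coloring:
  assumes "finite_simple_graph G"
  shows "\<exists>\<phi> :: 'a set \<Rightarrow> nat. inj_on \<phi> (edges (G :: 'a ugraph))"
  using finite_imp_inj_to_nat_seg[OF finite_edges[OF assms]] by blast

text \<open>Colours are copied through a map \<open>\<rho>\<close> on edges: \<open>{v, z}\<close>
  with \<open>z \<noteq> u\<close> goes to \<open>{u, h z}\<close>, every other edge stays. After
  composition with an injective colouring, two edges share a colour iff their images under
  \<open>\<rho>\<close> agree, so properness and equality of palettes become statements about
  \<open>\<rho>\<close>.\<close>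

lemma deg_eq_imp_ex_equal_palettes:
  assumes G: "finite_simple_graph G" and uv: "u \<noteq> v" and deg: "deg G u = deg G v"
    and not_same: "\<And>w. \<not> (nbhd G u - {v} = {w} \<and> nbhd G v - {u} = {w})"
  shows "\<exists>\<phi>. proper_edge_coloring G \<phi> \<and> palette G \<phi> u = palette G \<phi> v"
proof -
  note fin = finite_nbhd[OF G]
  have "card (nbhd G v - {u}) = card (nbhd G u - {v})"
    using deg nbhd_sym[of u G v] fin by (simp add: deg_def card_Diff_singleton_if)
  \<comment> \<open>A fixed point \<open>h z = z\<close> would give the same colour to
    \<open>{v, z}\<close> and \<open>{u, z}\<close>, which meet in \<open>z\<close>.\<close>
  then obtain h where h: "bij_betw h (nbhd G v - {u}) (nbhd G u - {v})"
    and hne: "\<And>z. z \<in> nbhd G v - {u} \<Longrightarrow> h z \<noteq> z"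
    using ex_bij_betw_no_fixpoint[of "nbhd G v - {u}" "nbhd G u - {v}"] fin not_same by blast
  have hin: "h z \<in> nbhd G u - {v}" if "z \<in> nbhd G v - {u}" for z
    using h that by (auto simp: bij_betw_def)
  obtain \<psi> :: "'a set \<Rightarrow> nat" where \<psi>: "inj_on \<psi> (edges G)"
    using ex_injective_coloring[OF G] by blast
  define moved where "moved e \<longleftrightarrow> e \<in> edges G \<and> v \<in> e \<and> u \<notin> e" for e
  \<comment> \<open>The description recovers the other end of a moved edge. Edges through
    \<open>u\<close>, in particular \<open>{u, v}\<close>, stay in place.\<close>
  define \<rho> where "\<rho> e = (if moved e then {u, h (THE z. e = {v, z})} else e)" for e
  have the: "(THE y. {v, z} = {v, y}) = z" for z
    by (auto simp: doubleton_eq_iff)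
  have \<rho>_moved: "\<rho> {v, z} = {u, h z}" if "z \<in> nbhd G v - {u}" for z
    using that uv by (auto simp: \<rho>_def moved_def the nbhd_def)
  have movedE: "\<exists>z \<in> nbhd G v - {u}. e = {v, z}" if "moved e" for e
    using that incident_edges_eq_image[OF G, of v] unfolding moved_def by blast
  have \<rho>_edge: "\<rho> e \<in> edges G" if "e \<in> edges G" for e
  proof (cases "moved e")
    case True
    then obtain z where "z \<in> nbhd G v - {u}" "e = {v, z}" using movedE by blast
    then show ?thesis using \<rho>_moved hin by (auto simp: nbhd_def)
  qed (use that in \<open>simp add: \<rho>_def\<close>)
  \<comment> \<open>An unmoved \<open>e'\<close> is its own image, hence equals
    \<open>{u, h z}\<close>. This is disjoint from \<open>{v, z}\<close>, because
    \<open>u \<noteq> v\<close>, \<open>z \<noteq> u\<close>, \<open>h z \<noteq> v\<close> and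
    \<open>h z \<noteq> z\<close>.\<close>
  have half: False if "moved e" "\<not> moved e'" "\<rho> e = \<rho> e'" "e \<inter> e' \<noteq> {}" for e e'
  proof -
    obtain z where z: "z \<in> nbhd G v - {u}" "e = {v, z}" using movedE \<open>moved e\<close> by blast
    then have "e' = {u, h z}" using that(2,3) \<rho>_moved[OF z(1)] by (metis \<rho>_def)
    then show False using z that hin[OF z(1)] hne[OF z(1)] uv by auto
  qed
  have \<rho>_proper: False
    if "e \<noteq> e'" "e \<inter> e' \<noteq> {}" "\<rho> e = \<rho> e'" for e e'
  proof (cases "moved e \<and> moved e'")
    case True
    then obtain z z' where z: "z \<in> nbhd G v - {u}" "e = {v, z}"
      and z': "z' \<in> nbhd G v - {u}" "e' = {v, z'}" using movedE by meson
    then have "{u, h z} = {u, h z'}" using \<rho>_moved that by simp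
    then have "h z = h z'" by (auto simp: doubleton_eq_iff)
    then have "z = z'" using h z z' by (meson bij_betw_imp_inj_on inj_onD)
    then show False using z z' that by simp
  next
    case False
    show False
      using half[of e e'] half[of e' e] that False
      by (metis Int_commute \<rho>_def)
  qed
  define \<phi> where "\<phi> = \<psi> \<circ> \<rho>"
  have "proper_edge_coloring G \<phi>"
    unfolding proper_edge_coloring_def \<phi>_def
    using \<rho>_proper \<rho>_edge \<psi> by (metis comp_apply inj_onD)
  moreover have "palette G \<phi> u = palette G \<phi> v"
  proof -
    have "(\<lambda>z. \<rho> {u, z}) ` nbhd G u = (\<lambda>z. {u, z}) ` nbhd G u"
      by (simp add: \<rho>_def moved_def)
    also have "\<dots> = (\<lambda>z. {u, z}) ` (nbhd G u - {v}) \<union> (if v \<in> nbhd G u then {{u, v}} else {})"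
      by auto
    also have "\<dots> = (\<lambda>z. {u, h z}) ` (nbhd G v - {u}) \<union> (if v \<in> nbhd G u then {{u, v}} else {})"
      unfolding bij_betw_imp_surj_on[OF h, symmetric] image_image ..
    also have "\<dots> = (\<lambda>z. \<rho> {v, z}) ` (nbhd G v - {u}) \<union> (if u \<in> nbhd G v then {\<rho> {v, u}} else {})"
      using \<rho>_moved nbhd_sym[of u G v] by (simp add: \<rho>_def moved_def insert_commute)
    also have "\<dots> = (\<lambda>z. \<rho> {v, z}) ` nbhd G v" by auto
    finally have "\<psi> ` (\<lambda>z. \<rho> {u, z}) ` nbhd G u = \<psi> ` (\<lambda>z. \<rho> {v, z}) ` nbhd G v" by simp
    then show ?thesis by (simp add: palette_eq_image[OF G] \<phi>_def image_image)
  qed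
  ultimately show ?thesis by blast
qed

section \<open>Palettes under an arbitrary proper colouring\<close>

lemma card_palette:
  assumes G: "finite_simple_graph G" and "proper_edge_coloring G \<phi>"
  shows "card (palette G \<phi> v) = deg G v"
proof -
  have "inj_on (\<lambda>z. \<phi> {v, z}) (nbhd G v)"
  proof (rule inj_onI, rule ccontr)
    fix y z assume "y \<in> nbhd G v" "z \<in> nbhd G v" "\<phi> {v, y} = \<phi> {v, z}" "y \<noteq> z"
    moreover have "{v, y} \<noteq> {v, z}" using \<open>y \<noteq> z\<close> by (auto simp: doubleton_eq_iff)
    ultimately show False using assms(2) by (auto simp: proper_edge_coloring_def nbhd_def)
  qed
  then show ?thesis by (simp add: palette_eq_image[OF G] deg_def card_image)
qed

text \<open>If \<open>u\<close> and \<open>v\<close> shared a palette, their degrees would agree, so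
  rigidity supplies \<open>w\<close>. The colour of \<open>{u, w}\<close> then occurs at
  \<open>v\<close> on an edge to \<open>u\<close> or to \<open>w\<close>; that edge is different
  from \<open>{u, w}\<close> but meets it, so the colouring is not proper.\<close>

lemma rigid_imp_inj_on_palette:
  assumes G: "finite_simple_graph G" and "rigid G" and \<phi>: "proper_edge_coloring G \<phi>"
  shows "inj_on (palette G \<phi>) (verts G)"
proof (rule inj_onI, rule ccontr)
  fix u v assume uv: "u \<in> verts G" "v \<in> verts G" "palette G \<phi> u = palette G \<phi> v" "u \<noteq> v"
  then have "deg G u = deg G v" using card_palette[OF G \<phi>] by metis
  then obtain w where w: "nbhd G u - {v} = {w}" "nbhd G v - {u} = {w}"
    using \<open>rigid G\<close> uv unfolding rigid_def by blast
  then have "\<phi> {u, w} \<in> palette G \<phi> v"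
    using uv(3) unfolding palette_eq_image[OF G] by blast
  then obtain z where z: "z \<in> nbhd G v" "\<phi> {u, w} = \<phi> {v, z}"
    unfolding palette_eq_image[OF G] by blast
  have "z = u \<or> z = w" using w z by blast
  then have "{u, w} \<noteq> {v, z}" "{u, w} \<inter> {v, z} \<noteq> {}"
    using w uv(4) by (auto simp: doubleton_eq_iff)
  then have "{u, w} \<noteq> {v, z} \<and> {u, w} \<inter> {v, z} \<noteq> {}" ..
  moreover have "{u, w} \<in> edges G" "{v, z} \<in> edges G" using w z by (auto simp: nbhd_def)
  ultimately have "\<phi> {u, w} \<noteq> \<phi> {v, z}"
    by (intro \<phi>[unfolded proper_edge_coloring_def, rule_format])
  then show False using z by simp
qed

text \<open>In a rigid graph every proper colouring attains the value \<open>card (verts G)\<close>,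
  and an injective colouring shows that there is one. A pair violating rigidity yields a colouring
  with a repeated palette, hence a smaller minimum.\<close>

lemma palette_index_eq_card_iff_rigid:
  fixes G :: "'a ugraph"
  assumes G: "finite_simple_graph G"
  shows "palette_index G = card (verts G) \<longleftrightarrow> rigid G"
proof
  assume "rigid G"
  obtain \<psi> :: "'a set \<Rightarrow> nat" where "inj_on \<psi> (edges G)"
    using ex_injective_coloring[OF G] by blast
  then have "proper_edge_coloring G \<psi>"
    unfolding proper_edge_coloring_def by (metis inj_onD)
  moreover have "card (palette G \<phi> ` verts G) = card (verts G)"
    if "proper_edge_coloring G \<phi>" for \<phi>
    using rigid_imp_inj_on_palette[OF G \<open>rigid G\<close> that] by (rule card_image)
  ultimately show "palette_index G = card (verts G)"
    unfolding palette_index_def by (intro Least_equality) force+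
next
  assume index: "palette_index G = card (verts G)"
  show "rigid G"
  proof (rule ccontr)
    assume "\<not> rigid G"
    then obtain u v where uv: "u \<in> verts G" "v \<in> verts G" "u \<noteq> v" "deg G u = deg G v"
      "\<And>w. \<not> (nbhd G u - {v} = {w} \<and> nbhd G v - {u} = {w})"
      unfolding rigid_def by blast
    then obtain \<phi> where \<phi>: "proper_edge_coloring G \<phi>" "palette G \<phi> u = palette G \<phi> v"
      using deg_eq_imp_ex_equal_palettes[OF G] by blast
    then have "\<not> inj_on (palette G \<phi>) (verts G)" using uv by (auto simp: inj_on_def)
    then have "card (palette G \<phi> ` verts G) < card (verts G)"
      using G by (metis card_image_le eq_card_imp_inj_on finite_simple_graph_def le_neq_implies_less)
    moreover have "palette_index G \<le> card (palette G \<phi> ` verts G)"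
      unfolding palette_index_def using \<phi> by (intro Least_le) blast
    ultimately show False using index by simp
  qed
qed

subsection \<open>Isomorphisms\<close>

lemma graph_isoI:
  assumes G: "finite_simple_graph G" and f: "bij_betw f (verts G) (verts H)"
    and N: "\<And>u. u \<in> verts G \<Longrightarrow> nbhd H (f u) = f ` nbhd G u"
  shows "graph_iso G H"
proof -
  have "{u, v} \<in> edges G \<longleftrightarrow> {f u, f v} \<in> edges H" if "u \<in> verts G" "v \<in> verts G" for u v
  proof -
    have "{f u, f v} \<in> edges H \<longleftrightarrow> f v \<in> f ` nbhd G u"
      using N[OF that(1)] by (auto simp: nbhd_def)
    also have "\<dots> \<longleftrightarrow> v \<in> nbhd G u"
      using f that nbhd_subset[OF G] by (meson bij_betw_imp_inj_on inj_on_image_mem_iff)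
    finally show ?thesis by (simp add: nbhd_def)
  qed
  then show ?thesis using f unfolding graph_iso_def by blast
qed

text \<open>Rigidity speaks of degrees and neighbourhoods alone, and \<open>f\<close> maps
  neighbourhoods onto neighbourhoods. As neighbours in \<open>H\<close> are vertices of
  \<open>H\<close>, the witness \<open>w\<close> can be pulled back to \<open>G\<close>.\<close>

lemma rigid_if_graph_iso:
  assumes G: "finite_simple_graph G" and H: "\<And>v. nbhd H v \<subseteq> verts H"
    and "graph_iso G H" "rigid H"
  shows "rigid G"
proof -
  obtain f where f: "bij_betw f (verts G) (verts H)"
    and E: "\<And>u v. u \<in> verts G \<Longrightarrow> v \<in> verts G \<Longrightarrow> {u, v} \<in> edges G \<longleftrightarrow> {f u, f v} \<in> edges H"
    using assms(3) unfolding graph_iso_def by blast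
  note inj = bij_betw_imp_inj_on[OF f] and NG = nbhd_subset[OF G]
  have N: "nbhd H (f u) = f ` nbhd G u" if "u \<in> verts G" for u
  proof (intro equalityI subsetI)
    fix y assume y: "y \<in> nbhd H (f u)"
    then obtain z where z: "z \<in> verts G" "y = f z"
      using H f by (metis bij_betw_imp_surj_on imageE subsetD)
    then show "y \<in> f ` nbhd G u" using E that y by (auto simp: nbhd_def)
  next
    fix y assume "y \<in> f ` nbhd G u"
    then show "y \<in> nbhd H (f u)" using E NG that by (fastforce simp: nbhd_def)
  qed
  have deg: "deg H (f u) = deg G u" if "u \<in> verts G" for u
    unfolding deg_def N[OF that] using inj NG by (metis card_image inj_on_subset)
  show ?thesis
    unfolding rigid_def
  proof (intro ballI impI, elim conjE)
    fix u v assume uv: "u \<in> verts G" "v \<in> verts G" "u \<noteq> v" "deg G u = deg G v"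
    have "f u \<in> verts H" "f v \<in> verts H" "f u \<noteq> f v" "deg H (f u) = deg H (f v)"
      using uv f inj deg by (auto simp: bij_betw_def inj_on_def)
    then obtain w where w: "nbhd H (f u) - {f v} = {w}" "nbhd H (f v) - {f u} = {w}"
      using \<open>rigid H\<close> unfolding rigid_def by blast
    have "nbhd H (f a) - {f b} = f ` (nbhd G a - {b})" if "a \<in> verts G" "b \<in> verts G" for a b
      using N[OF that(1)] inj_on_image_set_diff[OF inj, of "nbhd G a" "{b}"] NG that by auto
    then have im: "f ` (nbhd G u - {v}) = {w}" "f ` (nbhd G v - {u}) = {w}"
      using w uv by auto
    then obtain z where z: "z \<in> verts G" "f z = w" using NG by blast
    have "A = {z}" if "f ` A = {w}" "A \<subseteq> verts G" for A
    proof -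
      have "f ` A = f ` {z}" using that z by simp
      then show ?thesis using inj_on_image_eq_iff[OF inj, of A "{z}"] that z by simp
    qed
    then show "\<exists>w. nbhd G u - {v} = {w} \<and> nbhd G v - {u} = {w}"
      using im NG by (meson Diff_subset subset_trans)
  qed
qed

subsection \<open>The five families\<close>

lemma lessThan_3: "{..<3::nat} = {0, 1, 2}"
  by auto

lemma edges_complete_graph_3: "edges (complete_graph 3) = {{0, 1}, {0, 2}, {1, 2}}"
proof -
  have "e \<in> {{0, 1}, {0, 2}, {1, 2}}" if "e \<subseteq> {0, 1, 2}" "card e = 2" for e :: "nat set"
    using that by (auto simp: card_2_iff doubleton_eq_iff)
  moreover have "e \<subseteq> {0, 1, 2} \<and> card e = 2" if "e \<in> {{0, 1}, {0, 2}, {1, 2}}" for e :: "nat set"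
    using that by (elim insertE emptyE) auto
  ultimately show ?thesis
    unfolding complete_graph_def lessThan_3 snd_conv by (intro equalityI subsetI) blast+
qed

lemma verts_complete_graph_3: "verts (complete_graph 3) = {0, 1, 2}"
  by (simp add: complete_graph_def lessThan_3)

lemma edges_star_graph: "edges (star_graph j) = (\<lambda>i. {0, i}) ` {1..j}"
  by (auto simp: star_graph_def)

lemma verts_star_graph: "verts (star_graph j) = insert 0 {1..j}"
  by (auto simp: star_graph_def)

lemma verts_disjoint_union_K3_star:
  "verts (disjoint_union (complete_graph 3) (star_graph j)) =
     {Inl 0, Inl 1, Inl 2, Inr 0} \<union> Inr ` {1..j}"
  by (auto simp: disjoint_union_def verts_complete_graph_3 verts_star_graph)

lemma edges_disjoint_union_K3_star:
  "edges (disjoint_union (complete_graph 3) (star_graph j)) =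
     {{Inl 0, Inl 1}, {Inl 0, Inl 2}, {Inl 1, Inl 2}} \<union> (\<lambda>i. {Inr 0, Inr i}) ` {1..j}"
  by (simp add: disjoint_union_def edges_complete_graph_3 edges_star_graph image_image)

lemma verts_K3_hat: "verts (K3_hat j) = {Inl 0, Inl 1, Inl 2} \<union> Inr ` {1..j}"
  unfolding K3_hat_def identify_vertices_def Let_def fst_conv verts_disjoint_union_K3_star
  by (auto simp: image_iff)

lemma edges_K3_hat:
  "edges (K3_hat j) =
     {{Inl 0, Inl 1}, {Inl 0, Inl 2}, {Inl 1, Inl 2}} \<union> (\<lambda>i. {Inl 0, Inr i}) ` {1..j}"
  unfolding K3_hat_def identify_vertices_def Let_def snd_conv edges_disjoint_union_K3_star
  by (simp add: image_Un image_image insert_commute)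

lemma verts_K3_hat_plus:
  "verts (K3_hat_plus j) = {Inl 0, Inl 1, Inl 2, Inr 0} \<union> Inr ` {1..j}"
  by (simp add: K3_hat_plus_def add_edge_def verts_disjoint_union_K3_star)

lemma edges_K3_hat_plus:
  "edges (K3_hat_plus j) =
     {{Inl 0, Inr 0}, {Inl 0, Inl 1}, {Inl 0, Inl 2}, {Inl 1, Inl 2}} \<union>
     (\<lambda>i. {Inr 0, Inr i}) ` {1..j}"
  by (simp add: K3_hat_plus_def add_edge_def edges_disjoint_union_K3_star)

text \<open>Each family is a short list of edges, possibly followed by a star. This rule peels off
  the listed edges and the next one evaluates the star, so neighbourhoods are computed by
  rewriting.\<close>

lemma Collect_insert_edge:
  "{u. {v, u} \<in> insert {a, b} E} =
     (if v = a then {b} else {}) \<union> (if v = b then {a} else {}) \<union> {u. {v, u} \<in> E}"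
  by (auto simp: doubleton_eq_iff)

lemma Collect_star_edges:
  "{u. {v, u} \<in> (\<lambda>i. {c, h i}) ` I} =
     (if v = c then h ` I else {}) \<union> (if v \<in> h ` I then {c} else {})"
  by (auto simp: doubleton_eq_iff)

lemma nbhd_complete_graph_3:
  "nbhd (complete_graph 3) 0 = {1, 2}"
  "nbhd (complete_graph 3) (Suc 0) = {0, 2}"
  "nbhd (complete_graph 3) 2 = {0, 1}"
  unfolding nbhd_def edges_complete_graph_3 Un_insert_left Un_empty_left Collect_insert_edge Collect_star_edges
  by auto

lemma nbhd_star_graph:
  "nbhd (star_graph j) 0 = {1..j}"
  "i \<in> {1..j} \<Longrightarrow> nbhd (star_graph j) i = {0}"
  unfolding nbhd_def edges_star_graph Un_insert_left Un_empty_left Collect_insert_edge Collect_star_edges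
  by auto

lemma nbhd_disjoint_union_K3_star:
  "nbhd (disjoint_union (complete_graph 3) (star_graph j)) (Inl 0) = {Inl 1, Inl 2}"
  "nbhd (disjoint_union (complete_graph 3) (star_graph j)) (Inl (Suc 0)) = {Inl 0, Inl 2}"
  "nbhd (disjoint_union (complete_graph 3) (star_graph j)) (Inl 2) = {Inl 0, Inl 1}"
  "nbhd (disjoint_union (complete_graph 3) (star_graph j)) (Inr 0) = Inr ` {1..j}"
  "i \<in> {1..j} \<Longrightarrow> nbhd (disjoint_union (complete_graph 3) (star_graph j)) (Inr i) = {Inr 0}"
  unfolding nbhd_def edges_disjoint_union_K3_star Un_insert_left Un_empty_left Collect_insert_edge Collect_star_edges
  by auto

lemma nbhd_K3_hat:
  "nbhd (K3_hat j) (Inl 0) = {Inl 1, Inl 2} \<union> Inr ` {1..j}"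
  "nbhd (K3_hat j) (Inl (Suc 0)) = {Inl 0, Inl 2}"
  "nbhd (K3_hat j) (Inl 2) = {Inl 0, Inl 1}"
  "i \<in> {1..j} \<Longrightarrow> nbhd (K3_hat j) (Inr i) = {Inl 0}"
  unfolding nbhd_def edges_K3_hat Un_insert_left Un_empty_left Collect_insert_edge Collect_star_edges
  by auto

lemma nbhd_K3_hat_plus:
  "nbhd (K3_hat_plus j) (Inl 0) = {Inl 1, Inl 2, Inr 0}"
  "nbhd (K3_hat_plus j) (Inl (Suc 0)) = {Inl 0, Inl 2}"
  "nbhd (K3_hat_plus j) (Inl 2) = {Inl 0, Inl 1}"
  "nbhd (K3_hat_plus j) (Inr 0) = insert (Inl 0) (Inr ` {1..j})"
  "i \<in> {1..j} \<Longrightarrow> nbhd (K3_hat_plus j) (Inr i) = {Inr 0}"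
  unfolding nbhd_def edges_K3_hat_plus Un_insert_left Un_empty_left Collect_insert_edge Collect_star_edges
  by auto

lemma nbhd_subset_verts_families:
  "nbhd (complete_graph 3) u \<subseteq> verts (complete_graph 3)"
  "nbhd (star_graph j) u \<subseteq> verts (star_graph j)"
  "nbhd (disjoint_union (complete_graph 3) (star_graph j)) v \<subseteq>
     verts (disjoint_union (complete_graph 3) (star_graph j))"
  "nbhd (K3_hat j) v \<subseteq> verts (K3_hat j)"
  "nbhd (K3_hat_plus j) v \<subseteq> verts (K3_hat_plus j)"
  unfolding nbhd_def edges_complete_graph_3 verts_complete_graph_3 edges_star_graph
    verts_star_graph verts_disjoint_union_K3_star edges_disjoint_union_K3_star
    verts_K3_hat edges_K3_hat verts_K3_hat_plus edges_K3_hat_plus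
    Un_insert_left Un_empty_left Collect_insert_edge Collect_star_edges
  by (auto split: if_splits)

lemma card_Inr_image: "card (Inr ` A) = card A"
  by (simp add: card_image)

section \<open>Rigidity of the five families\<close>

lemma rigid_complete_graph_3: "rigid (complete_graph 3)"
  unfolding rigid_def verts_complete_graph_3 deg_def
  by (auto simp: nbhd_complete_graph_3)

text \<open>The bound separates the degree \<open>j\<close> of the centre from the degree 1 of the
  leaves.\<close>

lemma rigid_star_graph: "j \<ge> 2 \<Longrightarrow> rigid (star_graph j)"
  unfolding rigid_def verts_star_graph deg_def
  by (auto simp: nbhd_star_graph)

text \<open>The star centre has degree \<open>j\<close>, which must differ from the degree 2 of the
  triangle vertices and from 1.\<close>

lemma rigid_disjoint_union_K3_star:
  "j \<ge> 3 \<Longrightarrow> rigid (disjoint_union (complete_graph 3) (star_graph j))"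
  unfolding rigid_def verts_disjoint_union_K3_star deg_def
  by (auto simp: nbhd_disjoint_union_K3_star card_Inr_image)

lemma rigid_K3_hat: "j \<ge> 1 \<Longrightarrow> rigid (K3_hat j)"
  unfolding rigid_def verts_K3_hat deg_def
  by (auto simp: nbhd_K3_hat card_Inr_image card_insert_if)

text \<open>The star centre has degree \<open>j + 1\<close> and the triangle vertex joined to it has
  degree 3; \<open>j = 2\<close> would make these equal, and \<open>j = 1\<close> would give the
  centre degree 2 like the other triangle vertices.\<close>

lemma rigid_K3_hat_plus: "j \<ge> 3 \<Longrightarrow> rigid (K3_hat_plus j)"
  unfolding rigid_def verts_K3_hat_plus deg_def
  by (auto simp: nbhd_K3_hat_plus card_Inr_image card_insert_if)


section \<open>Recognising the families from their neighbourhoods\<close>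

lemma ex_bij_betw_1_to_card:
  assumes "finite L"
  shows "\<exists>g. bij_betw g L {1..card L}"
  using assms finite_same_card_bij[of L "{1..card L}"] by simp

lemma graph_iso_complete_graph_3I:
  assumes G: "finite_simple_graph G" and V: "verts G = {u, v, w}"
    and N: "nbhd G u = {v, w}" "nbhd G v = {u, w}" "nbhd G w = {u, v}"
  shows "graph_iso G (complete_graph 3)"
proof -
  have d: "u \<noteq> v" "u \<noteq> w" "v \<noteq> w" using not_in_nbhd_self[OF G] N by blast+
  define f where "f y = (if y = u then 0 else if y = v then 1 else 2 :: nat)" for y
  show ?thesis
  proof (rule graph_isoI[OF G, of f])
    show "bij_betw f (verts G) (verts (complete_graph 3))"
      unfolding V verts_complete_graph_3 using d by (auto simp: bij_betw_def inj_on_def f_def)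
    show "nbhd (complete_graph 3) (f y) = f ` nbhd G y" if "y \<in> verts G" for y
      using that d unfolding V by (auto simp: f_def N nbhd_complete_graph_3)
  qed
qed

lemma graph_iso_star_graphI:
  assumes G: "finite_simple_graph G" and V: "verts G = insert x (nbhd G x)"
    and N: "\<And>l. l \<in> nbhd G x \<Longrightarrow> nbhd G l = {x}"
  shows "graph_iso G (star_graph (deg G x))"
proof -
  define L where "L = nbhd G x"
  note V = V[folded L_def] and N = N[folded L_def]
  have xL: "x \<notin> L" using not_in_nbhd_self[OF G] by (simp add: L_def)
  obtain g where g: "bij_betw g L {1..deg G x}"
    using ex_bij_betw_1_to_card[of L] finite_nbhd[OF G] by (auto simp: L_def deg_def)
  have gL: "g ` L = {1..deg G x}" and inj: "inj_on g L" using g by (auto simp: bij_betw_def)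
  define f where "f y = (if y = x then 0 else g y)" for y
  have fL: "f ` L = {1..deg G x}" unfolding gL[symmetric] using xL by (auto simp: f_def)
  have g1: "g l \<in> {1..deg G x}" if "l \<in> L" for l using gL that by blast
  show ?thesis
  proof (rule graph_isoI[OF G, of f])
    have "inj_on f (insert x L)"
      using inj xL by (auto simp: inj_on_def f_def dest: g1)
    moreover have "f ` insert x L = insert 0 {1..deg G x}"
      unfolding image_insert fL by (simp add: f_def)
    ultimately show "bij_betw f (verts G) (verts (star_graph (deg G x)))"
      unfolding V verts_star_graph by (simp add: bij_betw_def)
    show "nbhd (star_graph (deg G x)) (f y) = f ` nbhd G y" if "y \<in> verts G" for y
    proof (cases "y = x")
      case True
      then show ?thesis using fL by (simp add: f_def nbhd_star_graph flip: L_def)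
    next
      case False
      then have "y \<in> L" using that V by simp
      then show ?thesis using N False nbhd_star_graph(2)[OF g1] by (simp add: f_def)
    qed
  qed
qed

lemma graph_iso_K3_hatI:
  fixes G :: "'a ugraph"
  assumes G: "finite_simple_graph G" and V: "verts G = {u, v, w} \<union> L"
    and N: "nbhd G u = {v, w}" "nbhd G v = {u, w}" "nbhd G w = {u, v} \<union> L"
    and NL: "\<And>l. l \<in> L \<Longrightarrow> nbhd G l = {w}"
  shows "graph_iso G (K3_hat (card L))"
proof -
  have d: "u \<noteq> v" "u \<noteq> w" "v \<noteq> w" using not_in_nbhd_self[OF G] N by blast+
  \<comment> \<open>Members of \<open>L\<close> have one neighbour, whereas \<open>u\<close>,
    \<open>v\<close> and \<open>w\<close> have at least two.\<close>
  have wL: "u \<notin> L" "v \<notin> L" "w \<notin> L" using NL N d by auto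
  have "finite L" using G V by (auto simp: finite_simple_graph_def)
  then obtain g where g: "bij_betw g L {1..card L}"
    using ex_bij_betw_1_to_card by blast
  have gL: "g ` L = {1..card L}" and inj: "inj_on g L" using g by (auto simp: bij_betw_def)
  define f :: "'a \<Rightarrow> nat + nat" where
    "f y = (if y = w then Inl 0 else if y = u then Inl 1 else if y = v then Inl 2 else Inr (g y))" for y
  have fL: "f ` L = Inr ` {1..card L}"
    unfolding gL[symmetric] image_image using wL by (intro image_cong) (auto simp: f_def)
  have f: "f w = Inl 0" "f u = Inl 1" "f v = Inl 2" using d by (auto simp: f_def)
  have fl: "f l = Inr (g l)" if "l \<in> L" for l using that wL by (auto simp: f_def)
  have g1: "g l \<in> {1..card L}" if "l \<in> L" for l using gL that by blast
  show ?thesis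
  proof (rule graph_isoI[OF G, of f])
    have "inj_on f ({u, v, w} \<union> L)"
      using inj d by (auto simp: inj_on_def f fl)
    moreover have "f ` ({u, v, w} \<union> L) = {Inl 0, Inl 1, Inl 2} \<union> Inr ` {1..card L}"
      unfolding image_Un fL by (auto simp: f)
    ultimately show "bij_betw f (verts G) (verts (K3_hat (card L)))"
      unfolding V verts_K3_hat by (simp add: bij_betw_def)
    fix y assume "y \<in> verts G"
    then consider "y \<in> {u, v, w}" | "y \<in> L" using V by blast
    then show "nbhd (K3_hat (card L)) (f y) = f ` nbhd G y"
    proof cases
      case 1
      then show ?thesis
        by (elim insertE emptyE) (simp_all add: insert_commute N f nbhd_K3_hat image_Un fL)
    next
      case 2
      then show ?thesis using nbhd_K3_hat(4)[OF g1] NL by (simp add: f fl)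
    qed
  qed
qed

text \<open>The two remaining families have the same vertex set, so one labelling serves both: the
  triangle goes to the left summand with \<open>w\<close> at the attachment vertex
  \<open>Inl 0\<close>, the star to the right one with centre \<open>x\<close>.\<close>

lemma ex_K3_star_labelling:
  assumes d: "u \<noteq> v" "u \<noteq> w" "v \<noteq> w" "x \<noteq> u" "x \<noteq> v" "x \<noteq> w"
    and wL: "u \<notin> L" "v \<notin> L" "w \<notin> L" "x \<notin> L" and "finite L"
  shows "\<exists>f :: 'a \<Rightarrow> nat + nat. f w = Inl 0 \<and> f u = Inl 1 \<and> f v = Inl 2 \<and> f x = Inr 0 \<and>
           f ` L = Inr ` {1..card L} \<and> inj_on f ({u, v, w, x} \<union> L)"
proof -
  obtain g where g: "bij_betw g L {1..card L}"
    using ex_bij_betw_1_to_card[OF \<open>finite L\<close>] by blast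
  have gL: "g ` L = {1..card L}" and inj: "inj_on g L" using g by (auto simp: bij_betw_def)
  define f :: "'a \<Rightarrow> nat + nat" where
    "f y = (if y = w then Inl 0 else if y = u then Inl 1 else if y = v then Inl 2
       else if y = x then Inr 0 else Inr (g y))" for y
  have fL: "f ` L = Inr ` {1..card L}"
    unfolding gL[symmetric] image_image using wL by (intro image_cong) (auto simp: f_def)
  have f: "f w = Inl 0" "f u = Inl 1" "f v = Inl 2" "f x = Inr 0"
    using d by (auto simp: f_def)
  have fl: "f l = Inr (g l)" if "l \<in> L" for l using that wL by (auto simp: f_def)
  have "inj_on f L" using inj by (auto simp: inj_on_def fl)
  have insert: "inj_on f (insert a A)" if "inj_on f A" "f a \<notin> f ` A" for a A
    using that by (simp add: inj_on_insert image_iff)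
  have "inj_on f ({u, v, w, x} \<union> L)"
    unfolding Un_insert_left Un_empty_left
    by (intro insert \<open>inj_on f L\<close>; unfold image_insert f fL; auto)
  then show ?thesis using f fL by blast
qed

lemma graph_iso_K3_hat_plusI:
  fixes G :: "'a ugraph"
  assumes G: "finite_simple_graph G" and V: "verts G = {u, v, w, x} \<union> L"
    and N: "nbhd G u = {v, w}" "nbhd G v = {u, w}" "nbhd G w = {u, v, x}" "nbhd G x = insert w L"
    and NL: "\<And>l. l \<in> L \<Longrightarrow> nbhd G l = {x}"
  shows "graph_iso G (K3_hat_plus (card L))"
proof -
  have d: "u \<noteq> v" "u \<noteq> w" "v \<noteq> w" "x \<noteq> w"
    using not_in_nbhd_self[OF G] N by blast+
  have wL: "u \<notin> L" "v \<notin> L" "w \<notin> L" "x \<notin> L"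
    using NL N d by auto
  \<comment> \<open>If \<open>x\<close> were \<open>u\<close> or \<open>v\<close>, comparing the two
    descriptions of its neighbourhood would put \<open>v\<close> or \<open>u\<close> into
    \<open>L\<close>.\<close>
  have d': "x \<noteq> u" "x \<noteq> v"
    using N d wL by auto
  have "finite L" using G V by (auto simp: finite_simple_graph_def)
  then obtain f :: "'a \<Rightarrow> nat + nat" where f: "f w = Inl 0" "f u = Inl 1" "f v = Inl 2" "f x = Inr 0"
    and fL: "f ` L = Inr ` {1..card L}" and inj: "inj_on f ({u, v, w, x} \<union> L)"
    using ex_K3_star_labelling[of u v w x L] d d' wL by auto
  show ?thesis
  proof (rule graph_isoI[OF G, of f])
    have "f ` ({u, v, w, x} \<union> L) = {Inl 0, Inl 1, Inl 2, Inr 0} \<union> Inr ` {1..card L}"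
      unfolding image_Un fL by (auto simp: f)
    then show "bij_betw f (verts G) (verts (K3_hat_plus (card L)))"
      unfolding V verts_K3_hat_plus using inj by (simp add: bij_betw_def)
    fix y assume "y \<in> verts G"
    then consider "y \<in> {u, v, w, x}" | "y \<in> L" using V by blast
    then show "nbhd (K3_hat_plus (card L)) (f y) = f ` nbhd G y"
    proof cases
      case 1
      then show ?thesis
        by (elim insertE emptyE) (simp_all add: insert_commute N f nbhd_K3_hat_plus fL)
    next
      case 2
      then obtain i where "f y = Inr i" "i \<in> {1..card L}" using fL by blast
      then show ?thesis using nbhd_K3_hat_plus(5) NL 2 by (simp add: f)
    qed
  qed
qed

lemma graph_iso_disjoint_union_K3_starI:
  fixes G :: "'a ugraph"
  assumes G: "finite_simple_graph G" and V: "verts G = {u, v, w, x} \<union> L"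
    and N: "nbhd G u = {v, w}" "nbhd G v = {u, w}" "nbhd G w = {u, v}" "nbhd G x = L"
    and NL: "\<And>l. l \<in> L \<Longrightarrow> nbhd G l = {x}" and "x \<notin> {u, v, w}"
  shows "graph_iso G (disjoint_union (complete_graph 3) (star_graph (card L)))"
    (is "graph_iso G ?H")
proof -
  have d: "u \<noteq> v" "u \<noteq> w" "v \<noteq> w"
    using not_in_nbhd_self[OF G] N by blast+
  have d': "x \<noteq> u" "x \<noteq> v" "x \<noteq> w" using assms(8) by auto
  have wL: "u \<notin> L" "v \<notin> L" "w \<notin> L" "x \<notin> L"
    using NL N d d' not_in_nbhd_self[OF G, of x] by auto
  have "finite L" using G V by (auto simp: finite_simple_graph_def)
  then obtain f :: "'a \<Rightarrow> nat + nat" where f: "f w = Inl 0" "f u = Inl 1" "f v = Inl 2" "f x = Inr 0"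
    and fL: "f ` L = Inr ` {1..card L}" and inj: "inj_on f ({u, v, w, x} \<union> L)"
    using ex_K3_star_labelling[of u v w x L] d d' wL by auto
  show ?thesis
  proof (rule graph_isoI[OF G, of f])
    have "f ` ({u, v, w, x} \<union> L) = {Inl 0, Inl 1, Inl 2, Inr 0} \<union> Inr ` {1..card L}"
      unfolding image_Un fL by (auto simp: f)
    then show "bij_betw f (verts G) (verts ?H)"
      unfolding V verts_disjoint_union_K3_star using inj by (simp add: bij_betw_def)
    fix y assume "y \<in> verts G"
    then consider "y \<in> {u, v, w, x}" | "y \<in> L" using V by blast
    then show "nbhd ?H (f y) = f ` nbhd G y"
    proof cases
      case 1
      then show ?thesis
        by (elim insertE emptyE) (simp_all add: insert_commute N f nbhd_disjoint_union_K3_star fL)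
    next
      case 2
      then obtain i where "f y = Inr i" "i \<in> {1..card L}" using fL by blast
      then show ?thesis using nbhd_disjoint_union_K3_star(5) NL 2 by (simp add: f)
    qed
  qed
qed

subsection \<open>Classification of rigid graphs\<close>

text \<open>For nonempty \<open>K\<close>, the interval from 3 to \<open>card K + 1\<close> has
  fewer than \<open>card K\<close> elements, too few for distinct values.\<close>

lemma distinct_values_ge_3_imp_empty:
  fixes d :: "'a \<Rightarrow> nat"
  assumes "finite K" "inj_on d K" "\<And>y. y \<in> K \<Longrightarrow> 3 \<le> d y" "\<And>y. y \<in> K \<Longrightarrow> d y \<le> card K + 1"
  shows "K = {}"
proof -
  have "d ` K \<subseteq> {3..card K + 1}" using assms by auto
  then have "card K \<le> card {3..card K + 1}"
    using assms(2) by (metis card_image card_mono finite_atLeastAtMost)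
  then have "card K = 0" by simp
  then show ?thesis using assms(1) by simp
qed

text \<open>Rigidity gives two leaves a common neighbour, which is then the sole neighbour of each.
  Without leaves any \<open>x\<close> will do.\<close>

lemma rigid_imp_common_leaf_neighbour:
  assumes G: "finite_simple_graph G" and "rigid G"
  shows "\<exists>x. \<forall>l\<in>verts G. deg G l = 1 \<longrightarrow> nbhd G l = {x}"
proof (cases "\<exists>l\<in>verts G. deg G l = 1")
  case True
  then obtain l x where l: "l \<in> verts G" "deg G l = 1" "nbhd G l = {x}"
    by (auto simp: deg_def card_1_singleton_iff)
  have "nbhd G l' = {x}" if l': "l' \<in> verts G" "deg G l' = 1" for l'
  proof (cases "l' = l")
    case False
    then obtain w where w: "nbhd G l - {l'} = {w}" "nbhd G l' - {l} = {w}"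
      using \<open>rigid G\<close> l l' unfolding rigid_def by metis
    then have "x \<in> nbhd G l'" using l by blast
    then show ?thesis using l' by (auto simp: deg_def card_1_singleton_iff)
  qed (use l in simp)
  then show ?thesis by blast
qed blast

text \<open>Nonadjacent \<open>u\<close> and \<open>v\<close> would have \<open>w\<close> as their
  only neighbour, hence degree 1. So they are adjacent and span a triangle with
  \<open>w\<close>.\<close>

lemma rigid_imp_deg_2_neighbours:
  assumes G: "finite_simple_graph G" and "rigid G"
    and uv: "u \<in> verts G" "v \<in> verts G" "u \<noteq> v" "deg G u = 2" "deg G v = 2"
  shows "\<exists>w. nbhd G u = {v, w} \<and> nbhd G v = {u, w}"
proof -
  obtain w where w: "nbhd G u - {v} = {w}" "nbhd G v - {u} = {w}"
    using assms unfolding rigid_def by metis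
  have "v \<in> nbhd G u"
  proof (rule ccontr)
    assume "v \<notin> nbhd G u"
    then have "nbhd G u = {w}" using w by simp
    then show False using uv by (simp add: deg_def)
  qed
  then show ?thesis using w nbhd_sym[of u G v] by blast
qed

text \<open>Vertices are sorted by degree into leaves \<open>L\<close>, degree-2 vertices
  \<open>T\<close> and high-degree vertices \<open>H\<close>. Two vertices in \<open>T\<close> lie
  in a triangle with a third vertex \<open>w\<close>: degree 2 at \<open>w\<close> leads to the
  triangle, alone or beside a star, and larger degree to the two hat families. If \<open>T\<close>
  has at most one element, the graph is a star.\<close>

lemma rigid_imp_families:
  fixes G :: "'a ugraph"
  assumes G: "finite_simple_graph G" and ne: "verts G \<noteq> {}"
    and noiso: "\<not> (\<exists>v. isolated_vertex G v)" and rigid: "rigid G"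
  shows "graph_iso G (complete_graph 3)
       \<or> (\<exists>j\<ge>2. graph_iso G (star_graph j))
       \<or> (\<exists>j\<ge>1. graph_iso G (K3_hat j))
       \<or> (\<exists>j\<ge>3. graph_iso G (K3_hat_plus j))
       \<or> (\<exists>j\<ge>3. graph_iso G (disjoint_union (complete_graph 3) (star_graph j)))"
proof -
  define V N d where "V = verts G" and "N = nbhd G" and "d = deg G"
  define H where "H = {y \<in> V. 3 \<le> d y}"
  define L where "L = {y \<in> V. d y = 1}"
  define T where "T = {y \<in> V. d y = 2}"
  have finV: "finite V" using G by (simp add: V_def finite_simple_graph_def)
  have NV: "N y \<subseteq> V" for y using nbhd_subset[OF G] by (simp add: N_def V_def)
  have finN: "finite (N y)" for y using finite_nbhd[OF G] by (simp add: N_def)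
  have sym: "y \<in> N z \<longleftrightarrow> z \<in> N y" for y z using nbhd_sym by (simp add: N_def)
  have irr: "y \<notin> N y" for y using not_in_nbhd_self[OF G] by (simp add: N_def)
  have d_def': "d y = card (N y)" for y by (simp add: d_def N_def deg_def)
  have dpos: "d y > 0" if y: "y \<in> V" for y
  proof -
    obtain e where "e \<in> edges G" "y \<in> e"
      using noiso y by (auto simp: isolated_vertex_def V_def)
    then have "N y \<noteq> {}" using incident_edges_eq_image[OF G, of y] by (auto simp: N_def)
    then show ?thesis using finN by (simp add: d_def' card_gt_0_iff)
  qed
  have V: "V = L \<union> T \<union> H"
    using dpos unfolding L_def T_def H_def by fastforce
  have disj: "L \<inter> T = {}" "L \<inter> H = {}" "T \<inter> H = {}"
    unfolding L_def T_def H_def by auto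
  have finH: "finite H" using finV by (simp add: H_def)
  \<comment> \<open>When \<open>L\<close> is empty, \<open>x\<close> is arbitrary and need not be a
    vertex.\<close>
  obtain x where x: "\<And>l. l \<in> L \<Longrightarrow> N l = {x}"
    using rigid_imp_common_leaf_neighbour[OF G rigid] unfolding L_def N_def V_def d_def by blast
  have leafx: "y = x" if "l \<in> L" "l \<in> N y" for l y
    using x[OF that(1)] that(2) sym by blast
  have Lx: "L \<subseteq> N x" using x sym by blast
  have x_in: "x \<in> T \<union> H" if "l \<in> L" for l
  proof -
    have "x \<in> V" using x[OF that] NV by blast
    moreover have "x \<notin> L" using x irr by blast
    ultimately show ?thesis using V by blast
  qed
  \<comment> \<open>Equal degrees in \<open>H\<close> would confine a neighbourhood to two vertices,
    against degree at least 3.\<close>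
  have inj: "inj_on d K" if "K \<subseteq> H" for K
  proof (rule inj_onI, rule ccontr)
    fix y z assume "y \<in> K" "z \<in> K" and yz: "d y = d z" "y \<noteq> z"
    then have yzV: "y \<in> V" "z \<in> V" "3 \<le> d y" using that by (auto simp: H_def)
    then obtain w where "N y - {z} = {w}"
      using rigid yz unfolding rigid_def N_def d_def V_def by metis
    then have "N y \<subseteq> {w, z}" by blast
    then have "d y \<le> card {w, z}" unfolding d_def' by (intro card_mono) auto
    then show False using yzV by (simp add: card_insert_if split: if_splits)
  qed
  \<comment> \<open>The counting argument used in every case: vertices of \<open>K\<close> have
    neighbours only in \<open>M\<close>, so their degrees are at most
    \<open>card M - 1 \<le> card K + 1\<close>. The slack 2 leaves room in \<open>M\<close> for two
    vertices outside \<open>K\<close>.\<close>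
  have H_empty: "K = {}"
    if "K \<subseteq> H" "\<And>y. y \<in> K \<Longrightarrow> N y \<subseteq> M - {y}" "finite M" "card M \<le> card K + 2" "K \<subseteq> M" for K M
  proof (rule distinct_values_ge_3_imp_empty[of _ d])
    show "finite K" using that finH finite_subset by blast
    show "inj_on d K" using inj that by blast
    show "3 \<le> d y" if "y \<in> K" for y using that \<open>K \<subseteq> H\<close> by (auto simp: H_def)
    show "d y \<le> card K + 1" if "y \<in> K" for y
    proof -
      have "d y \<le> card (M - {y})" unfolding d_def'
        using \<open>finite M\<close> that \<open>\<And>y. y \<in> K \<Longrightarrow> N y \<subseteq> M - {y}\<close> by (intro card_mono) auto
      then show ?thesis using that \<open>K \<subseteq> M\<close> \<open>finite M\<close> \<open>card M \<le> card K + 2\<close>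
        by (simp add: card_Diff_singleton_if subset_iff split: if_splits)
    qed
  qed
  have card_le_Diff: "card H \<le> card (H - A) + card A" if "finite A" for A :: "'a set"
    using diff_card_le_card_Diff[OF that, of H] by simp
  have star: ?thesis if "V = insert x (N x)" "N x = L" "2 \<le> d x"
  proof -
    have "graph_iso G (star_graph (deg G x))"
      using that x unfolding V_def N_def by (intro graph_iso_star_graphI[OF G]) auto
    then show ?thesis using that by (auto simp: d_def)
  qed
  show ?thesis
  proof (cases "\<exists>u\<in>T. \<exists>v\<in>T. u \<noteq> v")
    case True
    then obtain u v where uv: "u \<in> T" "v \<in> T" "u \<noteq> v" by blast
    have pair: "\<exists>w. N a = {b, w} \<and> N b = {a, w}" if "a \<in> T" "b \<in> T" "a \<noteq> b" for a b
      using rigid_imp_deg_2_neighbours[OF G rigid, of a b] that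
      unfolding T_def V_def N_def d_def by simp
    obtain w where w: "N u = {v, w}" "N v = {u, w}" using pair uv by blast
    have Nw: "u \<in> N w" "v \<in> N w" using w sym by blast+
    have wV: "w \<in> V" using w NV by blast
    \<comment> \<open>Any further degree-2 vertex is adjacent to \<open>u\<close>, whose neighbours
      are \<open>v\<close> and \<open>w\<close>.\<close>
    have T_sub: "T \<subseteq> {u, v, w}"
    proof
      fix t assume "t \<in> T"
      then have "t = u \<or> t \<in> N u" using pair[of u t] uv by blast
      then show "t \<in> {u, v, w}" using w by blast
    qed
    show ?thesis
    proof (cases "d w = 2")
      case True
      then have wT: "w \<in> T" using wV by (simp add: T_def)
      have "N w = {u, v}"
        using True Nw uv finN card_subset_eq[of "N w" "{u, v}"] by (auto simp: d_def')
      note w = w this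
      have T: "T = {u, v, w}" using T_sub uv wT by blast
      have NT: "N t \<subseteq> T" if "t \<in> T" for t using that w T by auto
      \<comment> \<open>The triangle \<open>T\<close> is a whole component and leaves are adjacent
        only to \<open>x\<close>, so the remaining high-degree vertices see only
        \<open>H\<close>.\<close>
      have "H - {x} = {}"
      proof (rule H_empty)
        show "N y \<subseteq> H - {y}" if y: "y \<in> H - {x}" for y
        proof
          fix z assume z: "z \<in> N y"
          then have "z \<notin> L" using leafx y by blast
          moreover have "z \<notin> T" using NT[of z] z sym disj y by blast
          ultimately show "z \<in> H - {y}" using z NV V irr by blast
        qed
        show "card H \<le> card (H - {x}) + 2" using card_le_Diff[of "{x}"] by simp
      qed (use finH in auto)
      then consider "H = {}" | "H = {x}" by blast
      then show ?thesis
      proof cases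
        case 1
        have "L = {}"
        proof (rule ccontr)
          assume "L \<noteq> {}"
          then obtain l where l: "l \<in> L" by blast
          then have "x \<in> T" using x_in 1 by blast
          then show False using NT Lx l disj by blast
        qed
        then have "V = {u, v, w}" using V 1 T by simp
        then have "graph_iso G (complete_graph 3)"
          using w unfolding V_def N_def by (intro graph_iso_complete_graph_3I[OF G]) auto
        then show ?thesis by blast
      next
        case 2
        have "N x \<subseteq> L"
        proof
          fix z assume z: "z \<in> N x"
          then have "z \<notin> T" using NT[of z] sym disj 2 by blast
          then show "z \<in> L" using z NV V irr 2 by blast
        qed
        then have Nx: "N x = L" using Lx by blast
        have "3 \<le> card L" using 2 Nx by (force simp: H_def d_def')
        moreover have "graph_iso G (disjoint_union (complete_graph 3) (star_graph (card L)))"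
        proof (rule graph_iso_disjoint_union_K3_starI[OF G, of u v w x, folded V_def N_def])
          show "V = {u, v, w, x} \<union> L" using V 2 T by blast
          show "x \<notin> {u, v, w}" using 2 T disj by blast
        qed (use w Nx x in auto)
        ultimately show ?thesis by blast
      qed
    next
      case False
      have "card {u, v} \<le> d w" unfolding d_def' using Nw finN by (intro card_mono) auto
      then have dw: "3 \<le> d w" using False uv by simp
      then have wH: "w \<in> H" using wV by (simp add: H_def)
      then have T: "T = {u, v}" using T_sub uv disj by blast
      have NT: "N t \<subseteq> {u, v, w}" if "t \<in> T" for t using that w T by auto
      have xT: "x \<notin> T" if "l \<in> L" for l
        using NT[of x] Lx that disj T wH by blast
      have xH: "x \<in> H" if "l \<in> L" for l using xT[OF that] x_in[OF that] by blast
      \<comment> \<open>Leaves are attached only at \<open>x\<close>, and \<open>u\<close>,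
        \<open>v\<close> have no neighbour outside the triangle. Removing \<open>x\<close> and
        \<open>w\<close> from \<open>H\<close> uses up the slack 2.\<close>
      have "H - {x, w} = {}"
      proof (rule H_empty)
        show "N y \<subseteq> H - {y}" if y: "y \<in> H - {x, w}" for y
        proof
          fix z assume z: "z \<in> N y"
          then have "z \<notin> L" using leafx y by blast
          moreover have "z \<notin> T" using NT[of z] z sym disj y T by blast
          ultimately show "z \<in> H - {y}" using z NV V irr by blast
        qed
        have "card {x, w} \<le> 2" by (simp add: card_insert_if)
        then show "card H \<le> card (H - {x, w}) + 2" using card_le_Diff[of "{x, w}"] by simp
      qed (use finH in auto)
      then consider "H = {w}" | "H = {x, w}" "x \<noteq> w" using wH by blast
      then show ?thesis
      proof cases
        case 1
        have Lw: "N l = {w}" if "l \<in> L" for l using x xH 1 that by blast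
        have "N w \<subseteq> {u, v} \<union> L" using NV V irr 1 T by blast
        then have Nw': "N w = {u, v} \<union> L" using Nw Lw sym by blast
        have "L \<noteq> {}"
        proof
          assume "L = {}"
          then have "d w = 2" using Nw' uv by (simp add: d_def')
          then show False using False by simp
        qed
        moreover have "finite L" using finV by (simp add: L_def)
        ultimately have "1 \<le> card L" by (simp add: Suc_leI card_gt_0_iff)
        moreover have "graph_iso G (K3_hat (card L))"
        proof (rule graph_iso_K3_hatI[OF G, of u v w, folded V_def N_def])
          show "V = {u, v, w} \<union> L" using V 1 T by blast
        qed (use w Nw' Lw in auto)
        ultimately show ?thesis by blast
      next
        case 2
        have "z \<notin> L" if "z \<in> N w" for z using leafx[of z w] that 2 by blast
        then have sub: "N w \<subseteq> {u, v, x}" using NV V irr 2 T by blast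
        have xT: "x \<notin> T" using 2 disj by blast
        \<comment> \<open>Degree at least 3 forces \<open>w\<close> to be adjacent to
          \<open>x\<close>, and fixes its degree as exactly 3.\<close>
        have "card {u, v, x} \<le> card (N w)"
          using dw uv xT T by (simp add: d_def' card_insert_if)
        then have Nw': "N w = {u, v, x}" using card_seteq[OF _ sub] by blast
        have "z \<notin> T" if "z \<in> N x" for z using NT[of z] that sym 2 xT T by blast
        then have "N x \<subseteq> insert w L" using NV V irr 2 by blast
        then have Nx: "N x = insert w L" using Lx Nw' sym by blast
        have "w \<notin> L" using wH disj by blast
        moreover have "finite L" using finV by (simp add: L_def)
        ultimately have "d x = card L + 1" using Nx by (simp add: d_def')
        moreover have "d w = 3" using Nw' uv xT T by (auto simp: d_def')
        \<comment> \<open>Since \<open>d w = 3\<close> and degrees in \<open>H\<close> are distinct,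
          \<open>d x = card L + 1\<close> is at least 4; this is the bound on
          \<open>j\<close>.\<close>
        moreover have "d x \<noteq> d w" using inj[of H] 2 by (auto simp: inj_on_def)
        moreover have "3 \<le> d x" using 2 by (auto simp: H_def)
        ultimately have "3 \<le> card L" by simp
        moreover have "graph_iso G (K3_hat_plus (card L))"
        proof (rule graph_iso_K3_hat_plusI[OF G, of u v w x, folded V_def N_def])
          show "V = {u, v, w, x} \<union> L" using V 2 T by blast
        qed (use w Nw' Nx x in auto)
        ultimately show ?thesis by blast
      qed
    qed
  next
    case False
    \<comment> \<open>Here \<open>M\<close> is \<open>H \<union> T\<close>; its at most two extra
      vertices are \<open>x\<close> and a single degree-2 vertex.\<close>
    have "H - {x} = {}"
    proof (rule H_empty)
      have "card T \<le> 1"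
        using False finV by (simp add: T_def card_le_Suc0_iff_eq)
      then have "card (H \<union> T) \<le> card H + 1" using card_Un_le[of H T] by simp
      then show "card (H \<union> T) \<le> card (H - {x}) + 2" using card_le_Diff[of "{x}"] by simp
      show "N y \<subseteq> H \<union> T - {y}" if y: "y \<in> H - {x}" for y
        using NV[of y] V irr[of y] leafx[of _ y] y by blast
      show "finite (H \<union> T)" using finV by (simp add: H_def T_def)
    qed auto
    then have Hx: "H \<subseteq> {x}" by blast
    show ?thesis
    proof (cases "T = {}")
      case True
      \<comment> \<open>Otherwise every vertex would be a leaf, but the neighbour \<open>x\<close>
        of a leaf is not one.\<close>
      have "H \<noteq> {}" using x_in True V ne unfolding V_def[symmetric] by blast
      then have "H = {x}" using Hx by blast
      moreover from this have "N x = L" using Lx NV V True irr by blast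
      moreover have "3 \<le> d x" using \<open>H = {x}\<close> by (auto simp: H_def)
      ultimately show ?thesis using V True by (intro star) auto
    next
      case nonempty: False
      then obtain t where T: "T = {t}" using False by blast
      have dt: "d t = 2" using T by (auto simp: T_def)
      obtain p q where pq: "N t = {p, q}" "p \<noteq> q"
        using dt by (auto simp: d_def' card_2_iff)
      \<comment> \<open>A vertex other than \<open>x\<close> has no leaf neighbours, so both
        neighbours of \<open>t\<close> would lie in \<open>H \<subseteq> {x}\<close>. Hence
        \<open>t\<close> is the centre of a star with two leaves.\<close>
      have "x = t"
      proof (rule ccontr)
        assume "x \<noteq> t"
        then have "z = x" if "z \<in> N t" for z
          using that leafx[of z t] NV V T irr Hx by blast
        then show False using pq by blast
      qed
      then have "H = {}" using Hx T disj by blast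
      moreover from this have "N x = L" using Lx NV V T \<open>x = t\<close> irr by blast
      ultimately show ?thesis using V T \<open>x = t\<close> dt by (intro star) auto
    qed
  qed
qed

text \<open>Nonemptiness excludes the empty graph, whose palette index 0 equals its number of
  vertices although it is in no family.\<close>

theorem theorem5p1:
  fixes G :: "'a ugraph"
  assumes "finite_simple_graph G"
    and "verts G \<noteq> {}"
    and "\<not> (\<exists>v. isolated_vertex G v)"
  shows "palette_index G = card (verts G) \<longleftrightarrow>
           graph_iso G (complete_graph 3)
         \<or> (\<exists>j\<ge>2. graph_iso G (star_graph j))
         \<or> (\<exists>j\<ge>1. graph_iso G (K3_hat j))
         \<or> (\<exists>j\<ge>3. graph_iso G (K3_hat_plus j))
         \<or> (\<exists>j\<ge>3. graph_iso G (disjoint_union (complete_graph 3) (star_graph j)))"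
  unfolding palette_index_eq_card_iff_rigid[OF assms(1)]
  using rigid_imp_families[OF assms]
    rigid_if_graph_iso[OF assms(1) nbhd_subset_verts_families(1) _ rigid_complete_graph_3]
    rigid_if_graph_iso[OF assms(1) nbhd_subset_verts_families(2) _ rigid_star_graph]
    rigid_if_graph_iso[OF assms(1) nbhd_subset_verts_families(3) _ rigid_disjoint_union_K3_star]
    rigid_if_graph_iso[OF assms(1) nbhd_subset_verts_families(4) _ rigid_K3_hat]
    rigid_if_graph_iso[OF assms(1) nbhd_subset_verts_families(5) _ rigid_K3_hat_plus]
  by blast

end
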